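(* Let $\beta>0$ and $\lambda_0\in(0,1/\beta)$, and let $(\lambda_n)_{n\ge 0}$ be the real sequence defined by $\lambda_{n+1}=\lambda_n(1-\beta\lambda_n)$ for $n=0,1,2,\ldots$. Then $$\lim_{n\to\infty} n\,\lambda_n=\frac{1}{\beta}.$$ *)

theory Defs
  imports Complex_Main
begin

end

theory Submission
  imports Defs
begin

text \<open>
  The reciprocals satisfy \<open>1 / l (Suc n) - 1 / l n = \<beta> / (1 - \<beta> * l n)\<close>, which tends to \<open>\<beta>\<close>
  because \<open>l n\<close> decreases to the only fixed point \<open>0\<close>. By Stolz--Cesaro,
  \<open>(1 / l n) / n\<close> tends to \<open>\<beta>\<close> as well.
\<close>

text \<open>Stolz--Cesaro with denominators \<open>n\<close>. Past some \<open>N\<close> every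
  increment is within \<open>e / 2\<close> of \<open>L\<close>, so the deviation
  \<open>u n - real n * L\<close> grows in absolute value by at most \<open>e / 2\<close> per step;
  the other half of \<open>e\<close> absorbs its value at \<open>N\<close>.\<close>

lemma LIMSEQ_divide_of_increments:
  fixes u :: "nat \<Rightarrow> real"
  assumes "(\<lambda>n. u (Suc n) - u n) \<longlonglongrightarrow> L"
  shows "(\<lambda>n. u n / real n) \<longlonglongrightarrow> L"
proof (rule LIMSEQ_I)
  fix e :: real
  assume e: "e > 0"
  then obtain N where N: "\<And>n. n \<ge> N \<Longrightarrow> \<bar>u (Suc n) - u n - L\<bar> < e / 2"
    using LIMSEQ_D[OF assms, of "e / 2"] by auto
  define v where "v n = u n - real n * L" for n
  have v: "\<bar>v n\<bar> \<le> \<bar>v N\<bar> + real (n - N) * (e / 2)" if "n \<ge> N" for n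
    using that
  proof (induction n rule: dec_induct)
    case base
    then show ?case by simp
  next
    case (step n)
    have "v (Suc n) = v n + (u (Suc n) - u n - L)"
      by (simp add: v_def algebra_simps)
    then have "\<bar>v (Suc n)\<bar> \<le> \<bar>v n\<bar> + e / 2"
      using N[OF step.hyps(1)] by linarith
    moreover have "real (Suc n - N) * (e / 2) = real (n - N) * (e / 2) + e / 2"
      using step.hyps(1) by (simp add: Suc_diff_le distrib_right add_divide_distrib)
    ultimately show ?case
      using step.IH by linarith
  qed
  obtain M :: nat where M: "2 * \<bar>v N\<bar> / e < real M"
    using reals_Archimedean2 by blast
  \<comment> \<open>From \<open>M\<close> on, \<open>\<bar>v N\<bar>\<close> is below
    \<open>real n * e / 2\<close>; \<open>Suc N\<close> keeps \<open>n\<close> positive for the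
    division.\<close>
  have "norm (u n / real n - L) < e" if n: "n \<ge> max (Suc N) M" for n
  proof -
    have "2 * \<bar>v N\<bar> < real n * e"
      using M n e by (simp add: pos_divide_less_eq)
        (meson less_le_trans mult_right_mono of_nat_mono less_imp_le)
    moreover have "real (n - N) * (e / 2) \<le> real n * (e / 2)"
      using e by (intro mult_right_mono) auto
    moreover have "\<bar>v n\<bar> \<le> \<bar>v N\<bar> + real (n - N) * (e / 2)"
      using v n by simp
    ultimately have "\<bar>v n\<bar> < real n * e"
      by linarith
    moreover have "u n / real n - L = v n / real n"
      using n by (simp add: v_def field_simps)
    ultimately show ?thesis
      using n by (simp add: pos_divide_less_eq mult.commute)
  qed
  then show "\<exists>no. \<forall>n\<ge>no. norm (u n / real n - L) < e"
    by blast
qed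

theorem theorem2:
  fixes \<beta> :: real and l :: "nat \<Rightarrow> real"
  assumes "\<beta> > 0"
    and "l 0 \<in> {0<..<1 / \<beta>}"
    and "\<And>n. l (Suc n) = l n * (1 - \<beta> * l n)"
  shows "(\<lambda>n. real n * l n) \<longlonglongrightarrow> 1 / \<beta>"
proof -
  note rec = assms(3)
  \<comment> \<open>The two bounds feed each other: the upper one makes the next term positive, and
    positivity puts both factors of \<open>\<beta> * l (Suc n)\<close> below 1.\<close>
  have bounds: "0 < l n \<and> \<beta> * l n < 1" for n
  proof (induction n)
    case 0
    then show ?case using assms(1,2) by (simp add: field_simps)
  next
    case (Suc n)
    have "\<beta> * l (Suc n) = (\<beta> * l n) * (1 - \<beta> * l n)"
      by (simp add: rec)
    also have "\<dots> < 1 * 1"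
      using Suc assms(1) by (intro mult_strict_mono) auto
    finally show ?case using Suc by (simp add: rec)
  qed
  have "decseq l"
    using bounds assms(1) by (intro decseq_SucI) (simp add: rec mult_le_cancel_left1 less_imp_le)
  then obtain c where c: "l \<longlonglongrightarrow> c"
    using bounds decseq_convergent[of l 0] by (meson less_imp_le)
  have "(\<lambda>n. l (Suc n)) \<longlonglongrightarrow> c * (1 - \<beta> * c)"
    unfolding rec by (intro tendsto_intros c)
  then have "c = c * (1 - \<beta> * c)"
    by (rule LIMSEQ_unique[OF LIMSEQ_Suc[OF c]])
  then have "c = 0"
    using assms(1) by (simp add: algebra_simps)
  then have l0: "l \<longlonglongrightarrow> 0"
    using c by simp
  have "1 / l (Suc n) - 1 / l n = \<beta> / (1 - \<beta> * l n)" for n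
    using bounds[of n] by (simp add: rec field_simps)
  moreover have "(\<lambda>n. \<beta> / (1 - \<beta> * l n)) \<longlonglongrightarrow> \<beta> / (1 - \<beta> * 0)"
    by (intro tendsto_intros l0) simp
  ultimately have "(\<lambda>n. (1 / l n) / real n) \<longlonglongrightarrow> \<beta>"
    by (intro LIMSEQ_divide_of_increments) simp
  \<comment> \<open>Inverting is allowed since the limit \<open>\<beta>\<close> is nonzero. The
    inverted term equals \<open>real n * l n\<close> even at \<open>n = 0\<close>, where division by
    zero gives 0.\<close>
  from tendsto_divide[OF tendsto_const[of 1] this] show ?thesis
    using assms(1) by (simp add: mult.commute)
qed

end
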